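(* Let $p$ be a positive integer with $\tau(p)>m$, and fix $b\in\mathbb{R}^m$ and $C\in\mathbb{S}^n$ with $\operatorname{rank}C>n-p$. Then for a generic $\mathcal{A}$, i.e. for all $(A_1,\dots,A_m)\in(\mathbb{S}^n)^m$ outside a Lebesgue measure zero set, the following holds: if $\mathscr{X}$ is nonempty and $\min_{X\in\mathscr{X}}C\bullet X$ is attained, then problem (BM) has no spurious 2-critical points.
   Context: Let $\mathbb{S}^n$ be the space of real symmetric $n\times n$ matrices, with inner product $A\bullet B=\operatorname{trace}(A^TB)$ (also used for $A\in\mathbb{S}^n$, $B\in\mathbb{R}^{n\times n}$), and $\mathbb{S}^n_+$ the cone of positive semidefinite matrices. Let $m=m_1+m_2$, $A_1,\dots,A_m\in\mathbb{S}^n$, $\mathcal{A}^*(\lambda)=\sum_i\lambda_iA_i$. Let $\mathscr{X}=\{X\in\mathbb{S}^n_+ : A_i\bullet X=b_i \ (i\le m_1),\ A_i\bullet X\ge b_i\ (m_1<i\le m)\}$. Problem (BM) is $\min_{Y\in\mathbb{R}^{n\times p}} C\bullet YY^T$ subject to $YY^T\in\mathscr{X}$. For $Y$, let $I(Y)=\{i: A_i\bullet YY^T=b_i\}$ and $S(\lambda)=C-\mathcal{A}^*(\lambda)$. A point $Y$ is 2-critical for (BM) if $YY^T\in\mathscr{X}$ and there is $\lambda\in\mathbb{R}^{m_1}\times\mathbb{R}^{m_2}_+$ with $\lambda_i=0$ for $i\notin I(Y)$, $S(\lambda)Y=0$, and $S(\lambda)\bullet UU^T\ge 0$ for all $U\in\mathbb{R}^{n\times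 p}$ with $A_i\bullet UY^T=0$ for all $i\in I(Y)$. A critical point is spurious if it is not a global minimizer of (BM). $\tau(k)=\binom{k+1}{2}$. *)

theory Defs
  imports "HOL-Analysis.Analysis"
begin

(* Frobenius inner product  A \<bullet> B = trace (A^T B)  for (not necessarily square) matrices *)
definition frob :: "real^'p^'n \<Rightarrow> real^'p^'n \<Rightarrow> real" where
  "frob A B = trace (transpose A ** B)"

definition symmetric_mat :: "real^'n^'n \<Rightarrow> bool" where
  "symmetric_mat X \<longleftrightarrow> transpose X = X"

(* positive semidefinite (symmetric) matrices *)
definition psd :: "real^'n^'n \<Rightarrow> bool" where
  "psd X \<longleftrightarrow> symmetric_mat X \<and> (\<forall>v. v \<bullet> (X *v v) \<ge> 0)"

(* symmetrization; used to parametrize the space S^n of symmetric matrices *)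
definition symz :: "real^'n^'n \<Rightarrow> real^'n^'n" where
  "symz M = (1/2) *\<^sub>R (M + transpose M)"

(* tau(k) = binomial(k+1, 2) *)
definition tau :: "nat \<Rightarrow> nat" where
  "tau k = (k + 1) choose 2"

(* Feasible set; E is the set of equality-constraint indices, the others are \<ge> constraints *)
definition feas :: "('m \<Rightarrow> real^'n^'n) \<Rightarrow> real^'m \<Rightarrow> 'm set \<Rightarrow> (real^'n^'n) set" where
  "feas A b E = {X. psd X \<and> (\<forall>i\<in>E. frob (A i) X = b $ i) \<and> (\<forall>i. i \<notin> E \<longrightarrow> frob (A i) X \<ge> b $ i)}"

definition active :: "('m \<Rightarrow> real^'n^'n) \<Rightarrow> real^'m \<Rightarrow> real^'p^'n \<Rightarrow> 'm set" where
  "active A b Y = {i. frob (A i) (Y ** transpose Y) = b $ i}"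

definition Smat :: "real^'n^'n \<Rightarrow> ('m::finite \<Rightarrow> real^'n^'n) \<Rightarrow> real^'m \<Rightarrow> real^'n^'n" where
  "Smat C A lam = C - (\<Sum>i\<in>UNIV. (lam $ i) *\<^sub>R A i)"

definition two_critical ::
  "real^'n^'n \<Rightarrow> ('m::finite \<Rightarrow> real^'n^'n) \<Rightarrow> real^'m \<Rightarrow> 'm set \<Rightarrow> real^'p^'n \<Rightarrow> bool" where
  "two_critical C A b E Y \<longleftrightarrow>
     Y ** transpose Y \<in> feas A b E \<and>
     (\<exists>lam::real^'m.
        (\<forall>i. i \<notin> E \<longrightarrow> lam $ i \<ge> 0) \<and>
        (\<forall>i. i \<notin> active A b Y \<longrightarrow> lam $ i = 0) \<and>
        Smat C A lam ** Y = 0 \<and>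
        (\<forall>U::real^'p^'n. (\<forall>i\<in>active A b Y. frob (A i) (U ** transpose Y) = 0)
            \<longrightarrow> frob (Smat C A lam) (U ** transpose U) \<ge> 0))"

definition BM_global_min ::
  "real^'n^'n \<Rightarrow> ('m \<Rightarrow> real^'n^'n) \<Rightarrow> real^'m \<Rightarrow> 'm set \<Rightarrow> real^'p^'n \<Rightarrow> bool" where
  "BM_global_min C A b E Y \<longleftrightarrow>
     Y ** transpose Y \<in> feas A b E \<and>
     (\<forall>Y'::real^'p^'n. Y' ** transpose Y' \<in> feas A b E \<longrightarrow>
         frob C (Y ** transpose Y) \<le> frob C (Y' ** transpose Y'))"

end

theory Submission
  imports Defs
begin

(* A spurious 2-critical point Y has full column rank: a nonzero kernel vector e of Y makes
   every U = v e^T admissible in the second-order condition, so S(lambda) is positive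
   semidefinite, and then lambda certifies global optimality by weak duality.  Since
   rank C > n - p, the first-order condition S(lambda) Y = 0 forces some lambda_i0 to be
   nonzero.  After a change of basis, Y = E + K where E selects p coordinates sigma and K
   vanishes on them; a symmetric matrix is determined by its block off sigma, by K and by its
   product with Y, and S(lambda) Y = 0 expresses A_i0 Y through the other A_i and the ratios
   of the multipliers.  These m ratios can be stored in m of the tau(p) > m independent
   entries of the sigma-block of A_i0, so one such entry is free and may be taken to be 0.
   Hence the bad data lie in finitely many images of hyperplanes under differentiable
   self-maps of the parameter space, and these images are negligible. *)

lemma matrix_add_rdistrib: "((A::real^'n^'m) + B) ** C = A ** C + B ** C"
  by (simp add: matrix_matrix_mult_def vec_eq_iff sum.distrib algebra_simps)

lemma matrix_diff_rdistrib: "((A::real^'n^'m) - B) ** C = A ** C - B ** C"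
  by (simp add: matrix_matrix_mult_def vec_eq_iff sum_subtractf algebra_simps)

lemma matrix_sum_rdistrib:
  "finite I \<Longrightarrow> (\<Sum>i\<in>I. f i) ** (C::real^'p^'n) = (\<Sum>i\<in>I. f i ** C)"
  for f :: "'i \<Rightarrow> real^'n^'m"
  by (induction I rule: finite_induct) (auto simp: matrix_add_rdistrib)

lemma transpose_add: "transpose ((A::real^'n^'m) + B) = transpose A + transpose B"
  by (simp add: transpose_def vec_eq_iff)

lemma transpose_diff: "transpose ((A::real^'n^'m) - B) = transpose A - transpose B"
  by (simp add: transpose_def vec_eq_iff)

lemma transpose_zero [simp]: "transpose (0::real^'n^'m) = 0"
  by (simp add: transpose_def vec_eq_iff)

lemma transpose_sum:
  "finite I \<Longrightarrow> transpose (\<Sum>i\<in>I. f i) = (\<Sum>i\<in>I. transpose (f i :: real^'n^'m))"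
  by (induction I rule: finite_induct) (auto simp: transpose_add)

lemma symz_add: "symz (A + B) = symz A + symz B"
  by (simp add: symz_def transpose_add algebra_simps)

lemma symz_diff: "symz (A - B) = symz A - symz B"
  by (simp add: symz_def transpose_diff algebra_simps)

lemma symz_eq_self: "transpose A = A \<Longrightarrow> symz A = A"
  by (simp add: symz_def scaleR_2[symmetric])

lemma transpose_symz: "transpose (symz A) = symz A"
  by (simp add: symz_def transpose_add transpose_scalar add.commute)

lemma symz_symz: "symz (symz A) = symz A"
  by (simp add: symz_eq_self transpose_symz)

lemma sum_rotate3:
  "(\<Sum>i\<in>A. \<Sum>j\<in>B. \<Sum>k\<in>C. f i j k) = (\<Sum>k\<in>C. \<Sum>i\<in>A. \<Sum>j\<in>B. f i j k)"
proof -
  have "(\<Sum>i\<in>A. \<Sum>j\<in>B. \<Sum>k\<in>C. f i j k) = (\<Sum>i\<in>A. \<Sum>k\<in>C. \<Sum>j\<in>B. f i j k)"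
    by (rule sum.cong[OF refl], rule sum.swap)
  also have "\<dots> = (\<Sum>k\<in>C. \<Sum>i\<in>A. \<Sum>j\<in>B. f i j k)"
    by (rule sum.swap)
  finally show ?thesis .
qed

lemma frob_eq_sum_entries: "frob A X = (\<Sum>i\<in>UNIV. \<Sum>j\<in>UNIV. A $ i $ j * X $ i $ j)"
  unfolding frob_def trace_def matrix_matrix_mult_def transpose_def
  by simp (rule sum.swap)

lemma frob_gram_eq_sum_columns:
  fixes S :: "real^'n^'n" and Y :: "real^'p^'n"
  shows "frob S (Y ** transpose Y) = (\<Sum>k\<in>UNIV. column k Y \<bullet> (S *v column k Y))"
  unfolding frob_eq_sum_entries matrix_matrix_mult_def transpose_def column_def
    inner_vec_def matrix_vector_mult_def
  by (simp add: sum_distrib_left sum_distrib_right algebra_simps) (rule sum_rotate3)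

lemma frob_Smat:
  fixes C :: "real^'n^'n" and A :: "'m::finite \<Rightarrow> real^'n^'n"
  shows "frob (Smat C A lam) X = frob C X - (\<Sum>i\<in>UNIV. lam $ i * frob (A i) X)"
  unfolding Smat_def frob_eq_sum_entries
  by (simp add: sum_subtractf sum_component sum_distrib_left sum_distrib_right algebra_simps)
    (rule sum_rotate3[symmetric])

lemma matrix_vector_mult_column: "A *v column k B = column k (A ** B)"
  by (simp add: column_def matrix_vector_mult_def matrix_matrix_mult_def vec_eq_iff)

section \<open>Spurious critical points\<close>

lemma multiplier_certifies_BM_global_min:
  fixes C :: "real^'n^'n" and A :: "'m::finite \<Rightarrow> real^'n^'n" and Y :: "real^'p^'n"
  assumes feas: "Y ** transpose Y \<in> feas A b E"
    and sign: "\<forall>i. i \<notin> E \<longrightarrow> lam $ i \<ge> 0"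
    and slack: "\<forall>i. i \<notin> active A b Y \<longrightarrow> lam $ i = 0"
    and first_order: "Smat C A lam ** Y = 0"
    and psd: "\<And>v. v \<bullet> (Smat C A lam *v v) \<ge> 0"
  shows "BM_global_min C A b E Y"
  unfolding BM_global_min_def
proof (intro conjI allI impI feas)
  fix Y' :: "real^'p^'n"
  assume feas': "Y' ** transpose Y' \<in> feas A b E"
  have "frob (Smat C A lam) (Y ** transpose Y) = 0"
    unfolding frob_gram_eq_sum_columns matrix_vector_mult_column first_order
    by (simp add: column_def flip: zero_vec_def)
  moreover have "frob (Smat C A lam) (Y' ** transpose Y') \<ge> 0"
    by (simp add: frob_gram_eq_sum_columns psd sum_nonneg)
  moreover have "(\<Sum>i\<in>UNIV. lam $ i * frob (A i) (Y ** transpose Y)) = (\<Sum>i\<in>UNIV. lam $ i * b $ i)"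
    using slack by (intro sum.cong) (auto simp: active_def)
  moreover have "(\<Sum>i\<in>UNIV. lam $ i * b $ i) \<le> (\<Sum>i\<in>UNIV. lam $ i * frob (A i) (Y' ** transpose Y'))"
  proof (intro sum_mono)
    fix i
    show "lam $ i * b $ i \<le> lam $ i * frob (A i) (Y' ** transpose Y')"
      using feas' sign by (cases "i \<in> E") (auto simp: feas_def mult_left_mono)
  qed
  ultimately show "frob C (Y ** transpose Y) \<le> frob C (Y' ** transpose Y')"
    by (simp add: frob_Smat)
qed

lemma psd_if_second_order_and_kernel:
  fixes S :: "real^'n^'n" and Y :: "real^'p^'n"
  assumes second_order: "\<And>U::real^'p^'n. U ** transpose Y = 0 \<Longrightarrow> frob S (U ** transpose U) \<ge> 0"
    and kernel: "Y *v e = 0" "e \<noteq> 0"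
  shows "v \<bullet> (S *v v) \<ge> 0"
proof -
  define U :: "real^'p^'n" where "U = (\<chi> j k. v $ j * e $ k)"
  have "(U ** transpose Y) $ j $ l = v $ j * (Y *v e) $ l" for j l
    by (simp add: U_def matrix_matrix_mult_def matrix_vector_mult_def transpose_def
        sum_distrib_left algebra_simps)
  then have "U ** transpose Y = 0"
    using kernel(1) by (simp add: vec_eq_iff)
  then have "frob S (U ** transpose U) \<ge> 0"
    by (rule second_order)
  moreover have "frob S (U ** transpose U) = (e \<bullet> e) * (v \<bullet> (S *v v))"
  proof -
    have "column k U = e $ k *\<^sub>R v" for k
      by (simp add: U_def column_def vec_eq_iff mult.commute)
    then have "column k U \<bullet> (S *v column k U) = (e $ k * e $ k) * (v \<bullet> (S *v v))" for k
      by (simp add: matrix_vector_mult_scaleR del: scaleR_matrix_vector_assoc)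
    then show ?thesis
      by (simp add: frob_gram_eq_sum_columns inner_vec_def sum_distrib_right)
  qed
  moreover have "e \<bullet> e > 0"
    using kernel(2) by simp
  ultimately show ?thesis
    by (simp add: zero_le_mult_iff)
qed

lemma spurious_two_critical_full_column_rank:
  fixes C :: "real^'n^'n" and A :: "'m::finite \<Rightarrow> real^'n^'n" and Y :: "real^'p^'n"
  assumes critical: "two_critical C A b E Y" and spurious: "\<not> BM_global_min C A b E Y"
  obtains lam where "Smat C A lam ** Y = 0" and "inj ((*v) Y)"
proof -
  from critical obtain lam :: "real^'m" where
    sign: "\<forall>i. i \<notin> E \<longrightarrow> lam $ i \<ge> 0" and
    slack: "\<forall>i. i \<notin> active A b Y \<longrightarrow> lam $ i = 0" and
    first_order: "Smat C A lam ** Y = 0" and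
    second_order: "\<forall>U::real^'p^'n. (\<forall>i\<in>active A b Y. frob (A i) (U ** transpose Y) = 0)
            \<longrightarrow> frob (Smat C A lam) (U ** transpose U) \<ge> 0"
    unfolding two_critical_def by blast
  have "Y *v e = 0 \<Longrightarrow> e = 0" for e
  proof (rule ccontr)
    assume "Y *v e = 0" "e \<noteq> 0"
    then have "v \<bullet> (Smat C A lam *v v) \<ge> 0" for v
      using second_order by (intro psd_if_second_order_and_kernel) (auto simp: frob_eq_sum_entries)
    then have "BM_global_min C A b E Y"
      using critical sign slack first_order
      by (intro multiplier_certifies_BM_global_min) (auto simp: two_critical_def)
    with spurious show False ..
  qed
  then have "inj ((*v) Y)"
    using matrix_left_invertible_injective matrix_left_invertible_ker by blast
  with first_order show thesis
    by (rule that)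
qed

lemma rank_add_ncols_le_if_mult_eq_0:
  fixes C :: "real^'n^'n" and Y :: "real^'p^'n"
  assumes inj: "inj ((*v) Y)" and CY: "C ** Y = 0"
  shows "rank C + CARD('p) \<le> CARD('n)"
proof -
  let ?R = "range ((*v) Y)"
  let ?orth = "{y. \<forall>x \<in> ?R. orthogonal x y}"
  have "dim ?R = CARD('p)"
    using inj by (simp add: full_rank_injective[symmetric] rank_dim_range)
  moreover have "dim ?orth + dim ?R = CARD('n)"
    using dim_subspace_orthogonal_to_vectors[of ?R UNIV]
    by (simp add: linear_subspace_image subspace_UNIV)
  moreover have "rows C \<subseteq> ?orth"
  proof
    fix r
    assume "r \<in> rows C"
    then obtain i where r: "r = row i C"
      by (auto simp: rows_def)
    have "orthogonal (Y *v x) r" for x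
    proof -
      have "(C *v (Y *v x)) $ i = 0"
        using CY by (simp add: matrix_vector_mul_assoc)
      then show ?thesis
        by (simp add: r orthogonal_def matrix_vector_mul_component row_def inner_commute)
    qed
    then show "r \<in> ?orth"
      by auto
  qed
  then have "rank C \<le> dim ?orth"
    by (simp add: row_rank_def dim_subset)
  ultimately show ?thesis
    by simp
qed

lemma invertible_row_submatrix:
  fixes Y :: "real^'p^'n"
  assumes "inj ((*v) Y)"
  obtains \<sigma> :: "'p \<Rightarrow> 'n" where "inj \<sigma>" and "invertible (\<chi> k. Y $ \<sigma> k)"
proof -
  have "span (rows Y) = UNIV"
    using assms matrix_left_invertible_injective matrix_left_invertible_span_rows by blast
  obtain B where BR: "B \<subseteq> rows Y" and indB: "independent B" and RB: "rows Y \<subseteq> span B"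
    by (rule maximal_independent_subset)
  have spanB: "span B = UNIV"
    using \<open>span (rows Y) = UNIV\<close> RB by (metis top.extremum_uniqueI span_mono span_span)
  have "card B = CARD('p)"
  proof -
    have "card B = dim (span B)"
      using indB by (simp add: dim_eq_card_independent)
    then show ?thesis
      using spanB by simp
  qed
  moreover have "finite B"
    using indB independent_bound by blast
  ultimately obtain f where f: "bij_betw f (UNIV::'p set) B"
    using finite_same_card_bij[of "UNIV::'p set" B] by auto
  have "\<exists>j. Y $ j = f k" for k
  proof -
    obtain j where "f k = row j Y"
      using f BR by (auto simp: bij_betw_def rows_def)
    then show ?thesis
      by (auto simp: row_def vec_eq_iff)
  qed
  then obtain \<sigma> where \<sigma>: "\<And>k. Y $ \<sigma> k = f k"
    by metis
  have "inj \<sigma>"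
  proof (rule injI)
    fix k l
    assume "\<sigma> k = \<sigma> l"
    then have "f k = f l"
      by (metis \<sigma>)
    then show "k = l"
      using f by (auto simp: bij_betw_def inj_on_def)
  qed
  moreover have "rows (\<chi> k. Y $ \<sigma> k) = B"
    using f by (auto simp: rows_def row_def \<sigma> bij_betw_def)
  then have "invertible (\<chi> k. Y $ \<sigma> k)"
    using spanB invertible_left_inverse matrix_left_invertible_span_rows by metis
  ultimately show thesis
    by (rule that)
qed

section \<open>Coordinate blocks of symmetric matrices\<close>

definition coord_mat :: "('p \<Rightarrow> 'n) \<Rightarrow> real^'p^'n" where
  "coord_mat \<sigma> = (\<chi> j k. if j = \<sigma> k then 1 else 0)"

definition compl_proj :: "('p \<Rightarrow> 'n) \<Rightarrow> real^'n^'n" where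
  "compl_proj \<sigma> = (\<chi> j l. if j = l \<and> j \<notin> range \<sigma> then 1 else 0)"

lemma transpose_coord_mat_mult_entry:
  "(transpose (coord_mat \<sigma>) ** X) $ k $ j = X $ \<sigma> k $ j"
proof -
  have "(transpose (coord_mat \<sigma>) ** X) $ k $ j = (\<Sum>i\<in>UNIV. if i = \<sigma> k then X $ i $ j else 0)"
    unfolding coord_mat_def transpose_def matrix_matrix_mult_def vec_lambda_beta
    by (intro sum.cong) auto
  then show ?thesis
    by simp
qed

lemma mult_coord_mat_entry: "(X ** coord_mat \<sigma>) $ i $ k = X $ i $ \<sigma> k"
proof -
  have "(X ** coord_mat \<sigma>) $ i $ k = (\<Sum>j\<in>UNIV. if j = \<sigma> k then X $ i $ j else 0)"
    unfolding coord_mat_def matrix_matrix_mult_def vec_lambda_beta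
    by (intro sum.cong) auto
  then show ?thesis
    by simp
qed

lemma coord_block_entry:
  "(transpose (coord_mat \<sigma>) ** X ** coord_mat \<sigma>) $ k $ l = X $ \<sigma> k $ \<sigma> l"
  by (simp add: mult_coord_mat_entry transpose_coord_mat_mult_entry)

lemma compl_proj_mult_entry:
  "(compl_proj \<sigma> ** X) $ j $ l = (if j \<in> range \<sigma> then 0 else X $ j $ l)"
proof -
  have "(compl_proj \<sigma> ** X) $ j $ l = (\<Sum>i\<in>UNIV. if i = j then (if j \<in> range \<sigma> then 0 else X $ j $ l) else 0)"
    unfolding compl_proj_def matrix_matrix_mult_def vec_lambda_beta
    by (intro sum.cong) auto
  then show ?thesis
    by simp
qed

lemma transpose_coord_mat_mult_coord_mat:
  "inj \<sigma> \<Longrightarrow> transpose (coord_mat \<sigma>) ** coord_mat \<sigma> = mat 1"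
  by (simp add: transpose_coord_mat_mult_entry vec_eq_iff)
    (auto simp: coord_mat_def mat_def inj_eq)

lemma compl_proj_mult_coord_mat: "compl_proj \<sigma> ** coord_mat \<sigma> = 0"
  by (simp add: compl_proj_mult_entry vec_eq_iff) (auto simp: coord_mat_def)

lemma transpose_compl_proj: "transpose (compl_proj \<sigma>) = compl_proj \<sigma>"
  by (auto simp: compl_proj_def transpose_def vec_eq_iff)

lemma transpose_coord_mat_mult_compl_proj: "transpose (coord_mat \<sigma>) ** compl_proj \<sigma> = 0"
  by (metis compl_proj_mult_coord_mat matrix_transpose_mul transpose_compl_proj transpose_zero)

lemma compl_proj_idem: "compl_proj \<sigma> ** compl_proj \<sigma> = compl_proj \<sigma>"
  by (simp add: compl_proj_mult_entry vec_eq_iff) (auto simp: compl_proj_def)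

lemma compl_proj_add_coord_mat_mult_transpose:
  assumes "inj \<sigma>"
  shows "compl_proj \<sigma> + coord_mat \<sigma> ** transpose (coord_mat \<sigma>) = mat 1"
proof -
  have "(coord_mat \<sigma> ** transpose (coord_mat \<sigma>)) $ i $ j = (if i = j \<and> i \<in> range \<sigma> then 1 else 0)"
    for i j
  proof (cases "i \<in> range \<sigma>")
    case True
    then obtain k where k: "i = \<sigma> k"
      by auto
    have "(coord_mat \<sigma> ** transpose (coord_mat \<sigma>)) $ i $ j
        = (\<Sum>l\<in>UNIV. if l = k then (if j = \<sigma> k then 1 else 0) else 0)"
      unfolding coord_mat_def transpose_def matrix_matrix_mult_def vec_lambda_beta k
      using assms by (intro sum.cong) (auto simp: inj_eq)
    then show ?thesis
      using k by auto
  next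
    case False
    then show ?thesis
      by (auto simp: coord_mat_def transpose_def matrix_matrix_mult_def intro!: sum.neutral)
  qed
  then show ?thesis
    by (auto simp: compl_proj_def mat_def vec_eq_iff)
qed

lemma compl_proj_mult_eq_self: "(\<And>k. K $ \<sigma> k = 0) \<Longrightarrow> compl_proj \<sigma> ** K = K"
  by (auto simp: compl_proj_mult_entry vec_eq_iff)

lemma full_column_rank_normal_form:
  fixes Y :: "real^'p^'n"
  assumes "inj ((*v) Y)"
  obtains \<sigma> :: "'p \<Rightarrow> 'n" and G K where "inj \<sigma>" and "compl_proj \<sigma> ** K = K"
    and "Y ** G = coord_mat \<sigma> + K"
proof -
  obtain \<sigma> :: "'p \<Rightarrow> 'n" where "inj \<sigma>" and "invertible (\<chi> k. Y $ \<sigma> k)"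
    using invertible_row_submatrix[OF assms] .
  then obtain G where G: "(\<chi> k. Y $ \<sigma> k) ** G = mat 1"
    unfolding invertible_def by blast
  define K where "K = Y ** G - coord_mat \<sigma>"
  have "(Y ** G) $ \<sigma> k = ((\<chi> k. Y $ \<sigma> k) ** G) $ k" for k
    by (simp add: matrix_matrix_mult_def)
  then have "K $ \<sigma> k = 0" for k
    using \<open>inj \<sigma>\<close> by (auto simp: K_def G coord_mat_def mat_def vec_eq_iff inj_eq)
  then have "compl_proj \<sigma> ** K = K"
    by (rule compl_proj_mult_eq_self)
  moreover have "Y ** G = coord_mat \<sigma> + K"
    by (simp add: K_def)
  ultimately show thesis
    using \<open>inj \<sigma>\<close> that by blast
qed

lemma mult_coord_mat_compl_proj_products:
  fixes \<sigma> :: "'p::finite \<Rightarrow> 'n::finite"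
  assumes "inj \<sigma>"
  shows "X ** transpose (coord_mat \<sigma>) ** coord_mat \<sigma> = X"
    and "X' ** compl_proj \<sigma> ** coord_mat \<sigma> = 0"
    and "X ** transpose (coord_mat \<sigma>) ** compl_proj \<sigma> = 0"
    and "X' ** compl_proj \<sigma> ** compl_proj \<sigma> = X' ** compl_proj \<sigma>"
  by (simp_all add: transpose_coord_mat_mult_coord_mat[OF assms] compl_proj_mult_coord_mat
      transpose_coord_mat_mult_compl_proj compl_proj_idem matrix_mul_assoc[symmetric])

(* D is the block on the coordinates in range sigma, B the block on the complement,
   K the mixed block. *)
definition block_mat :: "('p \<Rightarrow> 'n) \<Rightarrow> real^'n^'n \<Rightarrow> real^'p^'n \<Rightarrow> real^'p^'p \<Rightarrow> real^'n^'n" where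
  "block_mat \<sigma> B K D = B + K ** transpose (coord_mat \<sigma>) + coord_mat \<sigma> ** transpose K
     + coord_mat \<sigma> ** D ** transpose (coord_mat \<sigma>)"

lemma transpose_block_mat:
  "transpose B = B \<Longrightarrow> transpose D = D \<Longrightarrow> transpose (block_mat \<sigma> B K D) = block_mat \<sigma> B K D"
  by (simp add: block_mat_def transpose_add matrix_transpose_mul matrix_mul_assoc add_ac)

lemma block_mat_blocks:
  fixes \<sigma> :: "'p::finite \<Rightarrow> 'n::finite" and S :: "real^'n^'n" and K :: "real^'p^'n"
    and D :: "real^'p^'p"
  assumes "inj \<sigma>" and "compl_proj \<sigma> ** K = K"
  defines "T \<equiv> block_mat \<sigma> (compl_proj \<sigma> ** S ** compl_proj \<sigma>) K D"
  shows "compl_proj \<sigma> ** T ** compl_proj \<sigma> = compl_proj \<sigma> ** S ** compl_proj \<sigma>"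
    and "compl_proj \<sigma> ** T ** coord_mat \<sigma> = K"
    and "transpose (coord_mat \<sigma>) ** T ** coord_mat \<sigma> = D"
proof -
  have EK: "transpose (coord_mat \<sigma>) ** K = 0"
  proof -
    have "transpose (coord_mat \<sigma>) ** K = transpose (coord_mat \<sigma>) ** compl_proj \<sigma> ** K"
      using assms(2) by (simp add: matrix_mul_assoc[symmetric])
    then show ?thesis
      by (simp add: transpose_coord_mat_mult_compl_proj)
  qed
  have "transpose K ** coord_mat \<sigma> = 0"
    using EK matrix_transpose_mul[of "transpose (coord_mat \<sigma>)" K] by simp
  then have KE: "X ** transpose K ** coord_mat \<sigma> = 0" for X :: "real^'p^'k"
    by (simp add: matrix_mul_assoc[symmetric])
  note simps = matrix_mul_assoc matrix_add_ldistrib matrix_add_rdistrib assms(2) EK KE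
    transpose_coord_mat_mult_coord_mat[OF assms(1)] compl_proj_mult_coord_mat
    transpose_coord_mat_mult_compl_proj compl_proj_idem
    mult_coord_mat_compl_proj_products[OF assms(1)] times0_left times0_right
  show "compl_proj \<sigma> ** T ** compl_proj \<sigma> = compl_proj \<sigma> ** S ** compl_proj \<sigma>"
    "compl_proj \<sigma> ** T ** coord_mat \<sigma> = K" "transpose (coord_mat \<sigma>) ** T ** coord_mat \<sigma> = D"
    unfolding T_def block_mat_def by (simp_all only: simps) simp_all
qed

lemma block_mat_eq:
  fixes \<sigma> :: "'p::finite \<Rightarrow> 'n::finite" and S :: "real^'n^'n"
  assumes "inj \<sigma>" and "transpose S = S"
  shows "block_mat \<sigma> (compl_proj \<sigma> ** S ** compl_proj \<sigma>) (compl_proj \<sigma> ** S ** coord_mat \<sigma>)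
      (transpose (coord_mat \<sigma>) ** S ** coord_mat \<sigma>) = S"
proof -
  let ?P = "compl_proj \<sigma>" and ?E = "coord_mat \<sigma>"
  have "S = (?P + ?E ** transpose ?E) ** S ** (?P + ?E ** transpose ?E)"
    using compl_proj_add_coord_mat_mult_transpose[OF assms(1)] by simp
  also have "\<dots> = block_mat \<sigma> (?P ** S ** ?P) (?P ** S ** ?E) (transpose ?E ** S ** ?E)"
    by (simp add: block_mat_def matrix_add_ldistrib matrix_add_rdistrib matrix_transpose_mul
        assms(2) transpose_compl_proj matrix_mul_assoc add_ac)
  finally show ?thesis ..
qed

(* For symmetric S with P K = K and Z = S (E + K), where E = coord_mat sigma and
   P = compl_proj sigma: P S E = P Z - (P S P) K and E^T S E = E^T Z - (P S E)^T K. *)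
definition sym_from_blocks :: "('p \<Rightarrow> 'n) \<Rightarrow> real^'n^'n \<Rightarrow> real^'p^'n \<Rightarrow> real^'p^'n \<Rightarrow> real^'n^'n" where
  "sym_from_blocks \<sigma> B K Z =
     (let W = compl_proj \<sigma> ** Z - B ** K
      in block_mat \<sigma> B W (transpose (coord_mat \<sigma>) ** Z - transpose W ** K))"

lemma sym_from_blocks_eq:
  fixes \<sigma> :: "'p::finite \<Rightarrow> 'n::finite" and S :: "real^'n^'n" and K :: "real^'p^'n"
  assumes "inj \<sigma>" and "transpose S = S" and PK: "compl_proj \<sigma> ** K = K"
  shows "sym_from_blocks \<sigma> (compl_proj \<sigma> ** S ** compl_proj \<sigma>) K (S ** (coord_mat \<sigma> + K)) = S"
proof -
  let ?P = "compl_proj \<sigma>" and ?E = "coord_mat \<sigma>"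
  have SPK: "X ** ?P ** K = X ** K" for X :: "real^'n^'k"
    using PK by (simp add: matrix_mul_assoc[symmetric])
  have "?P ** (S ** (?E + K)) - ?P ** S ** ?P ** K = ?P ** S ** ?E"
    by (simp add: SPK matrix_add_ldistrib matrix_mul_assoc)
  moreover have "transpose ?E ** (S ** (?E + K)) - transpose (?P ** S ** ?E) ** K
      = transpose ?E ** S ** ?E"
    by (simp add: SPK matrix_add_ldistrib matrix_mul_assoc matrix_transpose_mul assms(2)
        transpose_compl_proj)
  ultimately show ?thesis
    using block_mat_eq[OF assms(1,2)] by (simp add: sym_from_blocks_def Let_def)
qed

section \<open>Storing the multipliers in unordered pairs\<close>

definition upair :: "'a \<times> 'a \<Rightarrow> 'a set" where
  "upair x = {fst x, snd x}"

lemma card_range_upair: "card (range (upair :: 'p::finite \<times> 'p \<Rightarrow> 'p set)) = tau CARD('p)"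
proof -
  let ?sets = "\<lambda>k. {B. B \<subseteq> (UNIV::'p set) \<and> card B = k}"
  have range_eq: "range (upair :: 'p \<times> 'p \<Rightarrow> 'p set) = ?sets 1 \<union> ?sets 2"
  proof (intro set_eqI iffI)
    fix A
    assume "A \<in> range (upair :: 'p \<times> 'p \<Rightarrow> 'p set)"
    then obtain a b :: 'p where "A = {a, b}"
      by (auto simp: upair_def)
    then show "A \<in> ?sets 1 \<union> ?sets 2"
      by (auto simp: card_insert_if)
  next
    fix A
    assume "A \<in> ?sets 1 \<union> ?sets 2"
    then obtain a b where "A = {a, b}"
      by (auto simp: card_1_singleton_iff card_2_iff)
    then show "A \<in> range (upair :: 'p \<times> 'p \<Rightarrow> 'p set)"
      by (metis fst_conv snd_conv upair_def rangeI)
  qed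
  have "card (range (upair :: 'p \<times> 'p \<Rightarrow> 'p set)) = card (?sets 1) + card (?sets 2)"
    unfolding range_eq by (rule card_Un_disjoint) auto
  also have "\<dots> = (CARD('p) choose 1) + (CARD('p) choose 2)"
    using n_subsets[of "UNIV::'p set" 1] n_subsets[of "UNIV::'p set" 2] by simp
  also have "\<dots> = tau CARD('p)"
    by (simp add: tau_def numeral_2_eq_2)
  finally show ?thesis .
qed

lemma pair_code_exists:
  assumes "CARD('m) < tau CARD('p)"
  obtains \<iota> :: "'m::finite \<Rightarrow> 'p::finite \<times> 'p" and q :: "'p \<times> 'p"
  where "inj (upair \<circ> \<iota>)" and "upair q \<notin> range (upair \<circ> \<iota>)"
proof -
  let ?Q = "range (upair :: 'p \<times> 'p \<Rightarrow> 'p set)"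
  fix q :: "'p \<times> 'p"
  have "CARD('m) \<le> card (?Q - {upair q})"
    using assms by (simp add: card_range_upair)
  then obtain g :: "'m \<Rightarrow> 'p set" where g: "g ` UNIV \<subseteq> ?Q - {upair q}" "inj g"
    using card_le_inj[of "UNIV::'m set" "?Q - {upair q}"] by auto
  define \<iota> where "\<iota> i = inv upair (g i)" for i
  have "upair (\<iota> i) = g i" for i
    unfolding \<iota>_def using g(1) by (intro f_inv_into_f) auto
  then have "upair \<circ> \<iota> = g"
    by auto
  with g show thesis
    by (intro that[of \<iota> q]) auto
qed

definition pair_mat :: "'p \<times> 'p \<Rightarrow> real^'p^'p" where
  "pair_mat x = (\<chi> a b. if upair (a, b) = upair x then 1 else 0)"

lemma transpose_pair_mat: "transpose (pair_mat x) = pair_mat x"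
  by (auto simp: pair_mat_def transpose_def vec_eq_iff upair_def insert_commute)

lemma pair_mat_sum_entry:
  "(\<Sum>i\<in>I. c i *\<^sub>R pair_mat (\<iota> i)) $ fst x $ snd x = (\<Sum>i\<in>I. if upair x = upair (\<iota> i) then c i else 0)"
  by (simp add: pair_mat_def sum_component) (rule sum.cong; simp)

lemma pair_mat_sum_entry_code:
  fixes \<iota> :: "'m::finite \<Rightarrow> 'p::finite \<times> 'p"
  assumes "inj (upair \<circ> \<iota>)"
  shows "(\<Sum>i\<in>UNIV. c i *\<^sub>R pair_mat (\<iota> i)) $ fst (\<iota> j) $ snd (\<iota> j) = c j"
proof -
  have "upair (\<iota> j) = upair (\<iota> i) \<longleftrightarrow> i = j" for i
    using assms by (auto simp: inj_def)
  then show ?thesis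
    unfolding pair_mat_sum_entry by simp
qed

lemma pair_mat_sum_entry_free:
  assumes "upair q \<notin> range (upair \<circ> \<iota>)"
  shows "(\<Sum>i\<in>I. c i *\<^sub>R pair_mat (\<iota> i)) $ fst q $ snd q = 0"
  unfolding pair_mat_sum_entry using assms by (force intro: sum.neutral)

section \<open>A negligible cover of the bad data\<close>

lemma negligible_kernel_functional:
  fixes f :: "'a::euclidean_space \<Rightarrow> real"
  assumes "linear f" and "f x \<noteq> 0"
  shows "negligible {y. f y = 0}"
proof (rule negligible_lowdim)
  have "subspace {y. f y = 0}"
    using assms(1) by (rule linear_subspace_kernel)
  moreover have "{y. f y = 0} \<noteq> UNIV"
    using assms(2) by auto
  ultimately have "span {y. f y = 0} \<noteq> UNIV"
    by (metis span_eq_iff)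
  then show "dim {y. f y = 0} < DIM('a)"
    using dim_eq_full dim_subset_UNIV le_neq_implies_less by blast
qed

lemma (in bounded_linear) differentiable_compose:
  "g differentiable F \<Longrightarrow> (\<lambda>x. f (g x)) differentiable F"
  unfolding differentiable_def using has_derivative by blast

lemma bounded_bilinear_matrix_mult:
  "bounded_bilinear ((**) :: real^'n^'m \<Rightarrow> real^'p^'n \<Rightarrow> real^'p^'m)"
  by (rule bilinear_conv_bounded_bilinear[THEN iffD1])
    (simp add: bilinear_def linear_iff matrix_add_ldistrib matrix_add_rdistrib
      matrix_scalar_ac scalar_matrix_assoc)

lemma differentiable_matrix_mult:
  fixes f :: "'a::real_normed_vector \<Rightarrow> real^'n^'m" and g :: "'a \<Rightarrow> real^'p^'n"
  shows "f differentiable (at x) \<Longrightarrow> g differentiable (at x) \<Longrightarrow> (\<lambda>x. f x ** g x) differentiable (at x)"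
  unfolding differentiable_def using bounded_bilinear.FDERIV[OF bounded_bilinear_matrix_mult] by blast

lemma bounded_linear_transpose: "bounded_linear (transpose :: real^'n^'m \<Rightarrow> real^'m^'n)"
  by (rule linear_conv_bounded_linear[THEN iffD1]) (simp add: linear_iff transpose_add transpose_scalar)

lemma bounded_linear_axis: "bounded_linear (axis i :: 'a::euclidean_space \<Rightarrow> 'a^'n)"
  by (rule linear_conv_bounded_linear[THEN iffD1]) (simp add: linear_iff axis_def vec_eq_iff)

lemma differentiable_symz:
  fixes f :: "'a::real_normed_vector \<Rightarrow> real^'n^'n"
  shows "f differentiable (at x) \<Longrightarrow> (\<lambda>x. symz (f x)) differentiable (at x)"
  unfolding symz_def
  by (intro differentiable_scaleR differentiable_const differentiable_add
      bounded_linear.differentiable_compose[OF bounded_linear_transpose])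

definition param_domain :: "('p::finite \<Rightarrow> 'n::finite) \<Rightarrow> 'p \<times> 'p \<Rightarrow> 'm::finite \<Rightarrow> ((real^'n^'n)^'m) set"
  where "param_domain \<sigma> q i0 =
    {N. (transpose (coord_mat \<sigma>) ** symz (N $ i0) ** coord_mat \<sigma>) $ fst q $ snd q = 0}"

(* The entries of the sigma-block of X = symz (N $ i0) at the pairs iota i are read as the
   coefficients c; at a bad M they are 1 / lambda_i0 and lambda_i / lambda_i0, so that the
   first-order condition makes Z equal to A_i0 Y, from which sym_from_blocks rebuilds A_i0.
   The antisymmetric part of N $ i0 is kept, since symz forgets it. *)
definition param_map :: "real^'n^'n \<Rightarrow> 'm::finite \<Rightarrow> ('p::finite \<Rightarrow> 'n::finite) \<Rightarrow> ('m \<Rightarrow> 'p \<times> 'p)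
    \<Rightarrow> (real^'n^'n)^'m \<Rightarrow> (real^'n^'n)^'m" where
  "param_map C i0 \<sigma> \<iota> N =
     (let X = symz (N $ i0); E = coord_mat \<sigma>; P = compl_proj \<sigma>;
          K = P ** X ** E; Y = E + K;
          c = (\<lambda>i. (transpose E ** X ** E) $ fst (\<iota> i) $ snd (\<iota> i));
          Z = c i0 *\<^sub>R (C ** Y) - (\<Sum>i\<in>-{i0}. c i *\<^sub>R (symz (N $ i) ** Y))
      in N + axis i0 (sym_from_blocks \<sigma> (P ** X ** P) K Z - X))"

lemma negligible_param_domain:
  fixes \<sigma> :: "'p::finite \<Rightarrow> 'n::finite" and i0 :: "'m::finite"
  shows "negligible (param_domain \<sigma> q i0)"
proof -
  obtain a b where q: "q = (a, b)"
    by fastforce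
  let ?f = "\<lambda>N::(real^'n^'n)^'m. N $ i0 $ \<sigma> a $ \<sigma> b + N $ i0 $ \<sigma> b $ \<sigma> a"
  have "linear ?f"
    by (simp add: linear_iff algebra_simps)
  moreover have "?f (axis i0 (\<chi> j l. if j = \<sigma> a \<and> l = \<sigma> b then 1 else 0)) \<noteq> 0"
    by (auto simp: axis_def)
  ultimately have "negligible {N. ?f N = 0}"
    by (rule negligible_kernel_functional)
  moreover have "param_domain \<sigma> q i0 = {N. ?f N = 0}"
    unfolding param_domain_def q coord_block_entry by (simp add: symz_def transpose_def)
  ultimately show ?thesis
    by simp
qed

lemma differentiable_param_map:
  fixes C :: "real^'n::finite^'n" and N :: "(real^'n^'n)^'m::finite" and \<sigma> :: "'p::finite \<Rightarrow> 'n"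
  shows "param_map C i0 \<sigma> \<iota> differentiable (at N)"
proof -
  have component: "(\<lambda>N::(real^'n^'n)^'m. symz (N $ i)) differentiable (at N)" for i
    by (intro differentiable_symz bounded_linear.differentiable_compose[OF bounded_linear_vec_nth]
        differentiable_ident)
  show ?thesis
    unfolding param_map_def[abs_def] Let_def sym_from_blocks_def block_mat_def
    by (intro differentiable_add differentiable_diff differentiable_scaleR differentiable_sum
        differentiable_matrix_mult differentiable_const differentiable_ident component ballI finite
        bounded_linear.differentiable_compose[OF bounded_linear_axis]
        bounded_linear.differentiable_compose[OF bounded_linear_transpose]
        bounded_linear.differentiable_compose[OF bounded_linear_vec_nth])
qed

lemma negligible_param_image: "negligible (param_map C i0 \<sigma> \<iota> ` param_domain \<sigma> q i0)"
  by (intro negligible_differentiable_image_negligible negligible_param_domain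
      differentiable_at_imp_differentiable_on differentiable_param_map) simp

lemma solve_sum_scaleR_for_term:
  fixes v :: "'i \<Rightarrow> 'a::real_vector"
  assumes "finite I" and "j \<in> I" and "lam j \<noteq> 0"
  shows "(1 / lam j) *\<^sub>R (\<Sum>i\<in>I. lam i *\<^sub>R v i) - (\<Sum>i\<in>I - {j}. (lam i / lam j) *\<^sub>R v i) = v j"
  using assms by (simp add: sum.remove scaleR_add_right scaleR_sum_right)

lemma Smat_mult_eq_0_solve_component:
  fixes C :: "real^'n^'n" and A :: "'m::finite \<Rightarrow> real^'n^'n" and Y :: "real^'p^'n"
  assumes "lam $ i0 \<noteq> 0" and "Smat C A lam ** Y = 0"
  shows "(1 / lam $ i0) *\<^sub>R (C ** Y) - (\<Sum>i\<in>-{i0}. (lam $ i / lam $ i0) *\<^sub>R (A i ** Y)) = A i0 ** Y"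
proof -
  have "C ** Y = (\<Sum>i\<in>UNIV. lam $ i *\<^sub>R (A i ** Y))"
    using assms(2) by (simp add: Smat_def matrix_diff_rdistrib matrix_sum_rdistrib scalar_matrix_assoc)
  then show ?thesis
    using solve_sum_scaleR_for_term[of UNIV i0 "\<lambda>i. lam $ i" "\<lambda>i. A i ** Y"] assms(1)
    by (simp add: Compl_eq_Diff_UNIV)
qed

lemma mem_param_image:
  fixes M :: "(real^'n^'n)^'m" and lam :: "real^'m" and K :: "real^'p^'n"
    and \<sigma> :: "'p::finite \<Rightarrow> 'n::finite" and \<iota> :: "'m::finite \<Rightarrow> 'p \<times> 'p"
  assumes "inj \<sigma>" and \<iota>: "inj (upair \<circ> \<iota>)" and q: "upair q \<notin> range (upair \<circ> \<iota>)"
    and "lam $ i0 \<noteq> 0" and PK: "compl_proj \<sigma> ** K = K"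
    and first_order: "Smat C (\<lambda>i. symz (M $ i)) lam ** (coord_mat \<sigma> + K) = 0"
  shows "M \<in> param_map C i0 \<sigma> \<iota> ` param_domain \<sigma> q i0"
proof -
  let ?E = "coord_mat \<sigma>" and ?P = "compl_proj \<sigma>" and ?Y = "coord_mat \<sigma> + K"
  define S where "S = symz (M $ i0)"
  define c where "c i = (if i = i0 then 1 else lam $ i) / lam $ i0" for i
  define D where "D = (\<Sum>i\<in>UNIV. c i *\<^sub>R pair_mat (\<iota> i))"
  define T where "T = block_mat \<sigma> (?P ** S ** ?P) K D"
  define N where "N = M + axis i0 (T - S)"
  have "transpose T = T"
    unfolding T_def D_def
    by (intro transpose_block_mat)
      (simp_all add: S_def matrix_transpose_mul transpose_symz transpose_compl_proj
        transpose_sum transpose_scalar transpose_pair_mat matrix_mul_assoc)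
  then have symz_N: "symz (N $ i0) = T"
    by (simp add: N_def S_def symz_add symz_diff symz_symz symz_eq_self)
  have N_other: "N $ i = M $ i" if "i \<noteq> i0" for i
    using that by (simp add: N_def axis_def)
  note blocks = block_mat_blocks[OF \<open>inj \<sigma>\<close> PK, of S D, folded T_def]
  have coef: "D $ fst (\<iota> i) $ snd (\<iota> i) = c i" for i
    unfolding D_def by (rule pair_mat_sum_entry_code[OF \<iota>])
  have "N \<in> param_domain \<sigma> q i0"
    unfolding param_domain_def mem_Collect_eq symz_N blocks(3) D_def
    by (rule pair_mat_sum_entry_free[OF q])
  moreover have "param_map C i0 \<sigma> \<iota> N = M"
  proof -
    have "c i0 *\<^sub>R (C ** ?Y) - (\<Sum>i\<in>-{i0}. c i *\<^sub>R (symz (N $ i) ** ?Y)) = S ** ?Y"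
      using Smat_mult_eq_0_solve_component[OF \<open>lam $ i0 \<noteq> 0\<close> first_order]
      by (simp add: c_def N_other S_def)
    then have "param_map C i0 \<sigma> \<iota> N = N + axis i0 (sym_from_blocks \<sigma> (?P ** S ** ?P) K (S ** ?Y) - T)"
      by (simp add: param_map_def Let_def symz_N blocks coef)
    also have "\<dots> = M"
      using sym_from_blocks_eq[OF \<open>inj \<sigma>\<close> _ PK, of S]
      by (simp add: S_def transpose_symz N_def axis_def vec_eq_iff)
    finally show ?thesis .
  qed
  ultimately show ?thesis
    by (metis image_eqI)
qed

lemma spurious_critical_point_in_param_image:
  fixes C :: "real^'n^'n" and M :: "(real^'n^'n)^'m" and Y :: "real^'p^'n"
    and \<iota> :: "'m::finite \<Rightarrow> 'p::finite \<times> 'p"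
  assumes rank: "int (rank C) > int CARD('n) - int CARD('p)"
    and \<iota>: "inj (upair \<circ> \<iota>)" and q: "upair q \<notin> range (upair \<circ> \<iota>)"
    and critical: "two_critical C (\<lambda>i. symz (M $ i)) b E Y"
    and spurious: "\<not> BM_global_min C (\<lambda>i. symz (M $ i)) b E Y"
  shows "\<exists>i0 \<sigma>. M \<in> param_map C i0 \<sigma> \<iota> ` param_domain \<sigma> q i0"
proof -
  obtain lam where first_order: "Smat C (\<lambda>i. symz (M $ i)) lam ** Y = 0" and "inj ((*v) Y)"
    using spurious_two_critical_full_column_rank[OF critical spurious] .
  have "lam \<noteq> 0"
  proof
    assume "lam = 0"
    then have "C ** Y = 0"
      using first_order by (simp add: Smat_def)
    with \<open>inj ((*v) Y)\<close> have "rank C + CARD('p) \<le> CARD('n)"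
      by (rule rank_add_ncols_le_if_mult_eq_0)
    with rank show False
      by linarith
  qed
  then obtain i0 where "lam $ i0 \<noteq> 0"
    by (auto simp: vec_eq_iff)
  obtain \<sigma> :: "'p \<Rightarrow> 'n" and G K where "inj \<sigma>" and "compl_proj \<sigma> ** K = K"
    and "Y ** G = coord_mat \<sigma> + K"
    using full_column_rank_normal_form[OF \<open>inj ((*v) Y)\<close>] .
  moreover have "Smat C (\<lambda>i. symz (M $ i)) lam ** (coord_mat \<sigma> + K) = 0"
    by (simp only: \<open>Y ** G = coord_mat \<sigma> + K\<close>[symmetric] matrix_mul_assoc first_order times0_left)
  ultimately show ?thesis
    using mem_param_image[OF _ \<iota> q \<open>lam $ i0 \<noteq> 0\<close>] by blast
qed

theorem theorem5:
  fixes C :: "real^'n^'n" and b :: "real^'m" and E :: "'m set"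
  assumes "tau CARD('p) > CARD('m)"
      and "symmetric_mat C"
      and "int (rank C) > int CARD('n) - int CARD('p)"
  shows "negligible {M :: (real^'n^'n)^'m.
           \<not> ((feas (\<lambda>i. symz (M $ i)) b E \<noteq> {} \<and>
               (\<exists>X0\<in>feas (\<lambda>i. symz (M $ i)) b E. \<forall>X\<in>feas (\<lambda>i. symz (M $ i)) b E. frob C X0 \<le> frob C X))
              \<longrightarrow> (\<forall>Y::real^'p^'n. two_critical C (\<lambda>i. symz (M $ i)) b E Y
                      \<longrightarrow> BM_global_min C (\<lambda>i. symz (M $ i)) b E Y))}"
proof -
  obtain \<iota> :: "'m \<Rightarrow> 'p \<times> 'p" and q where \<iota>: "inj (upair \<circ> \<iota>)" and q: "upair q \<notin> range (upair \<circ> \<iota>)"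
    using pair_code_exists[OF assms(1)] .
  have cover: "M \<in> (\<Union>i0. \<Union>\<sigma>. param_map C i0 \<sigma> \<iota> ` param_domain \<sigma> q i0)"
    if "two_critical C (\<lambda>i. symz (M $ i)) b E Y" and "\<not> BM_global_min C (\<lambda>i. symz (M $ i)) b E Y"
    for M :: "(real^'n^'n)^'m" and Y :: "real^'p^'n"
    using spurious_critical_point_in_param_image[OF assms(3) \<iota> q that] by blast
  have negligible_piece: "negligible (\<Union>\<sigma>. param_map C i0 \<sigma> \<iota> ` param_domain \<sigma> q i0)" for i0
    by (rule negligible_Union) (auto simp: negligible_param_image)
  have "negligible (\<Union>i0. \<Union>\<sigma>. param_map C i0 \<sigma> \<iota> ` param_domain \<sigma> q i0)"
    by (rule negligible_Union) (auto simp: negligible_piece)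
  then show ?thesis
    by (rule negligible_subset) (blast intro: cover)
qed

end
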